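(* Let $C = A \sqcup B$ be a disjoint union of finite sets of integers. For each $u \in \mathfrak{S}_A$ and $v \in \mathfrak{S}_B$, one has the following expansion: \[ F^{\mathrm{cyc}}_{|A|,\mathrm{cDes}(u)} \cdot F^{\mathrm{cyc}}_{|B|,\mathrm{cDes}(v)} = \sum_{[w] \in [u] \,\sqcup\!\sqcup_{\mathrm{cyc}}\, [v] } F^{\mathrm{cyc}}_{|C|,\mathrm{cDes}(w)}. \]
   Context: For a finite set $A$ of size $a$, $\mathfrak{S}_A$ is the set of bijections $u:[a]\to A$, viewed as words $u=(u_1,\ldots,u_a)$. For a finite set of integers $A$ and $u\in\mathfrak{S}_A$, the cyclic descent set is $\mathrm{cDes}(u):=\{1\le i\le a : u_i>u_{i+1}\}$ with the convention $u_{a+1}:=u_1$; for $|A|\le 1$ one sets $\mathrm{cDes}(u):=\varnothing$. The cyclic class $[u]$ is the equivalence class of $u$ under cyclic rotations $(u_1,\ldots,u_a)\sim(u_{i+1},\ldots,u_a,u_1,\ldots,u_i)$; $\mathrm{cDes}(w)$ depends on $[w]$ only up to cyclic shift, and $F^{\mathrm{cyc}}_{n,J}$ is invariant under cyclic shifts of $J$. For disjoint $A,B$, a cyclic shuffle of $[u]$ and $[v]$ is a class $[w]$, $w\in\mathfrak{S}_{A\sqcup B}$, having a representative that is a shuffle (i.e., contains both as subwords) of some cyclic shift of $u$ and some cyclic shift of $v$; $[u]\,\sqcup\!\sqcup_{\mathrm{cyc}}\,[v]$ denotes the set of all such cyclic shuffles. For $n\ge1$ and $J\subseteq[n]$, the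 fundamental cyclic quasi-symmetric function is $F^{\mathrm{cyc}}_{n,J}:=\sum x_{w_1}x_{w_2}\cdots x_{w_n}$, summed over all pairs $(w,k)$ with $w=(w_1,\ldots,w_n)$ a word of positive integers and $k\in[n]$ such that (i) $w_k\le w_{k+1}\le\cdots\le w_n\le w_1\le\cdots\le w_{k-1}$, and (ii) for every $j\in J\setminus\{k-1\}$, $w_j<w_{j+1}$ (indices modulo $n$). Also $F^{\mathrm{cyc}}_{0,\varnothing}:=1$. *)

theory Defs
  imports
    "HOL-Library.Multiset"
    "HOL-Library.Sublist"
    "HOL-Combinatorics.Multiset_Permutations"
begin

section \<open>Formal power series in countably many variables\<close>

text \<open>
  A series with integer coefficients in commuting variables \<open>x\<^sub>i\<close> is given by its
  coefficients; the multiset \<open>{#i\<^sub>1, \<dots>, i\<^sub>r#}\<close> stands for the monomial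
  \<open>x\<^bsub>i\<^sub>1\<^esub> \<cdots> x\<^bsub>i\<^sub>r\<^esub>\<close>.
\<close>

typedef mvps = "UNIV :: (nat multiset \<Rightarrow> int) set"
  morphisms mv_coeff Abs_mvps
  by simp

setup_lifting type_definition_mvps

definition splits :: "'a multiset \<Rightarrow> ('a multiset \<times> 'a multiset) set" where
  "splits M = {(N, K). N + K = M}"

lemma finite_splits [simp, intro]: "finite (splits M)"
proof -
  let ?S = "mset ` {xs. set xs \<subseteq> set_mset M \<and> length xs \<le> size M}"
  have fin: "finite ?S"
    by (intro finite_imageI finite_lists_length_le) simp
  have mem: "N \<in> ?S" if "N \<subseteq># M" for N
  proof -
    obtain xs where xs: "mset xs = N" using ex_mset by blast
    have "set xs \<subseteq> set_mset M" "length xs \<le> size M"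
      using that xs by (auto dest: mset_subset_eqD size_mset_mono)
    then show ?thesis using xs by blast
  qed
  have "splits M \<subseteq> ?S \<times> ?S"
    unfolding splits_def using mem by (auto simp del: mem_Collect_eq)
  then show ?thesis
    using fin by (meson finite_SigmaI finite_subset)
qed

instantiation mvps :: comm_ring_1
begin

lift_definition zero_mvps :: mvps is "\<lambda>_. 0" .

lift_definition one_mvps :: mvps is "\<lambda>M. if M = {#} then 1 else 0" .

lift_definition plus_mvps :: "mvps \<Rightarrow> mvps \<Rightarrow> mvps" is "\<lambda>f g M. f M + g M" .

lift_definition minus_mvps :: "mvps \<Rightarrow> mvps \<Rightarrow> mvps" is "\<lambda>f g M. f M - g M" .

lift_definition uminus_mvps :: "mvps \<Rightarrow> mvps" is "\<lambda>f M. - f M" .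

lift_definition times_mvps :: "mvps \<Rightarrow> mvps \<Rightarrow> mvps" is
  "\<lambda>f g M. \<Sum>(N, K)\<in>splits M. f N * g K" .

instance
proof
  fix f g h :: mvps
  show "f * g * h = f * (g * h)"
  proof (transfer, rule ext)
    fix f g h :: "nat multiset \<Rightarrow> int" and M
    have "(\<Sum>(P, K)\<in>splits M. (\<Sum>(N, L)\<in>splits P. f N * g L) * h K)
        = (\<Sum>((P, K), (N, L))\<in>(SIGMA x:splits M. splits (fst x)). f N * g L * h K)"
      by (simp add: sum_distrib_right case_prod_unfold sum.Sigma)
    also have "\<dots> = (\<Sum>((N, Q), (L, K))\<in>(SIGMA x:splits M. splits (snd x)). f N * (g L * h K))"
      by (rule sum.reindex_bij_witness
            [where i = "\<lambda>((N, Q), (L, K)). ((N + L, K), (N, L))"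
               and j = "\<lambda>((P, K), (N, L)). ((N, L + K), (L, K))"])
         (auto simp: splits_def add.assoc mult.assoc)
    also have "\<dots> = (\<Sum>(N, Q)\<in>splits M. f N * (\<Sum>(L, K)\<in>splits Q. g L * h K))"
      by (simp add: sum_distrib_left case_prod_unfold sum.Sigma)
    finally show "(\<Sum>(P, K)\<in>splits M. (\<Sum>(N, L)\<in>splits P. f N * g L) * h K)
        = (\<Sum>(N, Q)\<in>splits M. f N * (\<Sum>(L, K)\<in>splits Q. g L * h K))" .
  qed
  show "f * g = g * f"
  proof (transfer, rule ext)
    fix f g :: "nat multiset \<Rightarrow> int" and M
    show "(\<Sum>(N, K)\<in>splits M. f N * g K) = (\<Sum>(N, K)\<in>splits M. g N * f K)"
      by (rule sum.reindex_bij_witness[where i = prod.swap and j = prod.swap])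
         (auto simp: splits_def add.commute mult.commute)
  qed
  show "1 * f = f"
  proof (transfer, rule ext)
    fix f :: "nat multiset \<Rightarrow> int" and M
    have "sum (\<lambda>(N, K). (if N = {#} then 1 else 0) * f K) {({#} :: nat multiset, M)}
        = (\<Sum>(N, K)\<in>splits M. (if N = {#} then 1 else 0) * f K)"
      by (intro sum.mono_neutral_left finite_splits ballI)
         (auto simp: splits_def split: if_splits)
    then show "(\<Sum>(N, K)\<in>splits M. (if N = {#} then 1 else 0) * f K) = f M"
      by simp
  qed
  show "(f + g) * h = f * h + g * h"
    by transfer (auto simp: case_prod_unfold distrib_right sum.distrib)
  show "(0 :: mvps) \<noteq> 1"
    by transfer (auto simp: fun_eq_iff)
qed (transfer; auto simp: fun_eq_iff)+

end

section \<open>Cyclic descents and cyclic shuffles\<close>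

text \<open>
  Words are lists, so the letter \<open>u\<^sub>i\<close> is \<open>u ! (i - 1)\<close>, and its cyclic successor
  \<open>u\<^sub>i\<^sub>+\<^sub>1\<close> is \<open>u ! (i mod length u)\<close>.  The set of words \<open>\<SS>\<^sub>A\<close> is
  \<^const>\<open>permutations_of_set\<close> \<open>A\<close>.  For words of length at most one the set below is empty.
\<close>

definition cDes :: "int list \<Rightarrow> nat set" where
  "cDes u = {i \<in> {1..length u}. u ! (i - 1) > u ! (i mod length u)}"

definition cyc_class :: "'a list \<Rightarrow> 'a list set" where
  "cyc_class u = {rotate i u | i. True}"

definition cyc_shuffles :: "'a list \<Rightarrow> 'a list \<Rightarrow> 'a list set set" where
  "cyc_shuffles u v =
     {cyc_class w | w. w \<in> permutations_of_set (set u \<union> set v) \<and>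
        (\<exists>w' \<in> cyc_class w. \<exists>u' \<in> cyc_class u. \<exists>v' \<in> cyc_class v. subseq u' w' \<and> subseq v' w')}"

lemma finite_cyc_shuffles: "finite (cyc_shuffles u v)"
proof -
  have "cyc_shuffles u v \<subseteq> cyc_class ` permutations_of_set (set u \<union> set v)"
    by (auto simp: cyc_shuffles_def)
  then show ?thesis
    by (rule finite_subset) simp
qed

section \<open>Fundamental cyclic quasi-symmetric functions\<close>

text \<open>
  The index \<open>k - 1\<close> removed from \<open>J\<close> is read modulo \<open>n\<close>, like all other indices:
  for \<open>k = 1\<close> the position that carries no strictness condition is \<open>n\<close>.
\<close>

definition cyc_pairs :: "nat \<Rightarrow> nat set \<Rightarrow> (nat list \<times> nat) set" where
  "cyc_pairs n J =
     {(w, k). length w = n \<and> (\<forall>i \<in> set w. i \<ge> 1) \<and> k \<in> {1..n} \<and>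
        sorted (rotate (k - 1) w) \<and>
        (\<forall>j \<in> J. j mod n \<noteq> (k - 1) mod n \<longrightarrow> w ! (j - 1) < w ! (j mod n))}"

text \<open>
  The coefficient of a monomial in the sum of all \<open>x\<^bsub>w\<^sub>1\<^esub> \<cdots> x\<^bsub>w\<^sub>n\<^esub>\<close> is the number of
  pairs \<open>(w, k)\<close> whose word \<open>w\<close> has that monomial as its product.
\<close>

definition Fcyc :: "nat \<Rightarrow> nat set \<Rightarrow> mvps" where
  "Fcyc n J =
     (if n = 0 then 1
      else Abs_mvps (\<lambda>M. int (card {(w, k). (w, k) \<in> cyc_pairs n J \<and> mset w = M})))"

lemma finite_cyc_pairs_mset: "finite {(w, k). (w, k) \<in> cyc_pairs n J \<and> mset w = M}"
proof -
  have "{(w, k). (w, k) \<in> cyc_pairs n J \<and> mset w = M} \<subseteq> permutations_of_multiset M \<times> {1..n}"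
    by (auto simp: cyc_pairs_def permutations_of_multiset_def)
  then show ?thesis
    by (rule finite_subset) simp
qed

end

theory Submission
  imports Defs "HOL-Library.FuncSet" "HOL-Library.Product_Lexorder"
begin

text \<open>
  A pair \<open>(x, k)\<close> counted by \<open>F\<^sup>c\<^sup>y\<^sup>c\<close> for a word \<open>u\<close> amounts to a labelling \<open>f\<close> of the letters
  (\<open>f u\<^sub>i = x\<^sub>i\<close>) that is a \<open>P\<close>-partition of the rotation of \<open>u\<close> starting at \<open>u\<^sub>k\<close>: listing the
  letters in that order, the pairs \<open>(f a, a)\<close> increase lexicographically.  Every labelling \<open>f\<close> of
  a finite alphabet is a \<open>P\<close>-partition of exactly one word, so the series of \<open>u\<close> enumerates the
  labellings whose word is a rotation of \<open>u\<close>.  Restricting labellings of \<open>A \<squnion> B\<close> to \<open>A\<close> and \<open>B\<close>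
  restricts their words, and a word belongs to a cyclic shuffle of \<open>[u]\<close> and \<open>[v]\<close> iff its
  restrictions to \<open>A\<close> and \<open>B\<close> are rotations of \<open>u\<close> and \<open>v\<close>.
\<close>

section \<open>Rotations, subwords and cyclic classes\<close>

lemma self_in_cyc_class: "u \<in> cyc_class u"
  unfolding cyc_class_def by (metis (mono_tags, lifting) mem_Collect_eq rotate0 id_apply)

lemma cyc_class_trans: "w \<in> cyc_class v \<Longrightarrow> v \<in> cyc_class u \<Longrightarrow> w \<in> cyc_class u"
  unfolding cyc_class_def by (auto simp: rotate_rotate)

lemma cyc_class_sym:
  assumes "v \<in> cyc_class u"
  shows "u \<in> cyc_class v"
proof -
  from assms obtain i where v: "v = rotate i u" by (auto simp: cyc_class_def)
  \<comment> \<open>The exponent completes \<open>i\<close> to a multiple of the length. As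
    \<open>i\<close> may exceed the length, \<open>length u - i\<close> could be truncated.\<close>
  have "rotate (length u * i - i) v = rotate (length u * i) u" if "u \<noteq> []"
  proof -
    have "i \<le> length u * i" using that by (cases u) auto
    then show ?thesis by (simp add: v rotate_rotate)
  qed
  moreover have "rotate (length u * i) u = u"
    by (simp add: rotate_conv_mod[of "length u * i"])
  ultimately have "\<exists>k. u = rotate k v"
    using v by (cases "u = []") (auto dest: sym)
  then show ?thesis by (auto simp: cyc_class_def)
qed

lemma cyc_class_eq: "v \<in> cyc_class u \<Longrightarrow> cyc_class v = cyc_class u"
  using cyc_class_sym cyc_class_trans by blast

lemma cyc_class_invariants:
  assumes "v \<in> cyc_class u"
  shows "set v = set u" "distinct v = distinct u"
  using assms by (auto simp: cyc_class_def)

text \<open>Moving the first letter to the end rotates the filtered word by one if the letter is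
  kept, and leaves it unchanged otherwise.\<close>

lemma filter_rotate_in_cyc_class: "filter P (rotate i w) \<in> cyc_class (filter P w)"
proof (induction i)
  case 0
  then show ?case by (simp add: self_in_cyc_class)
next
  case (Suc i)
  have step: "filter P (rotate1 xs) \<in> cyc_class (filter P xs)" for xs
  proof (cases xs)
    case (Cons x ys)
    show ?thesis
    proof (cases "P x")
      case True
      then have "filter P (rotate1 xs) = rotate 1 (filter P xs)" by (simp add: Cons)
      then show ?thesis unfolding cyc_class_def by blast
    next
      case False
      then show ?thesis by (simp add: Cons self_in_cyc_class)
    qed
  qed (simp add: self_in_cyc_class)
  show ?case using cyc_class_trans[OF step Suc] by simp
qed

lemma filter_mem_cyc_class:
  assumes "w' \<in> cyc_class w"
  shows "filter P w' \<in> cyc_class u \<longleftrightarrow> filter P w \<in> cyc_class u"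
proof -
  have *: "filter P y \<in> cyc_class (filter P x)" if "y \<in> cyc_class x" for x y
    using that filter_rotate_in_cyc_class by (auto simp: cyc_class_def)
  show ?thesis
    using *[OF assms] *[OF cyc_class_sym[OF assms]] cyc_class_trans by blast
qed

lemma subseq_distinct_eq_filter:
  assumes "subseq xs ys" "distinct ys"
  shows "filter (\<lambda>x. x \<in> set xs) ys = xs"
  using assms filter_in_nths by (auto simp: subseq_conv_nths)

text \<open>As \<open>w\<close> is distinct, a subword is fixed by its letters, so \<open>u'\<close>
  and \<open>v'\<close> can only be the filters of \<open>w'\<close>. Filtering respects rotation,
  which carries the condition from \<open>w'\<close> to \<open>w\<close>.\<close>

lemma cyclic_shuffle_iff:
  assumes "distinct w"
  shows "(\<exists>w' \<in> cyc_class w. \<exists>u' \<in> cyc_class u. \<exists>v' \<in> cyc_class v. subseq u' w' \<and> subseq v' w')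
    \<longleftrightarrow> filter (\<lambda>x. x \<in> set u) w \<in> cyc_class u \<and> filter (\<lambda>x. x \<in> set v) w \<in> cyc_class v"
    (is "?L \<longleftrightarrow> ?R")
proof
  assume ?L
  then obtain w' u' v' where w': "w' \<in> cyc_class w" and u': "u' \<in> cyc_class u" "subseq u' w'"
    and v': "v' \<in> cyc_class v" "subseq v' w'" by blast
  have "distinct w'" using w' assms cyc_class_invariants by blast
  then have "filter (\<lambda>x. x \<in> set u) w' \<in> cyc_class u" "filter (\<lambda>x. x \<in> set v) w' \<in> cyc_class v"
    using subseq_distinct_eq_filter[of u' w'] subseq_distinct_eq_filter[of v' w']
      u' v' cyc_class_invariants(1) by metis+
  then show ?R using filter_mem_cyc_class[OF w'] by blast
next
  assume ?R
  then show ?L using self_in_cyc_class subseq_filter_left by blast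
qed

section \<open>Words of labellings\<close>

text \<open>The lexicographic order on pairs encodes weak increase of \<open>f\<close> along
  \<open>w\<close> and strictness at descents at once, so that existence and uniqueness of the word
  reduce to sorting.\<close>

definition word_partition :: "('a::linorder \<Rightarrow> nat) \<Rightarrow> 'a list \<Rightarrow> bool" where
  "word_partition f w \<longleftrightarrow> sorted_wrt (<) (map (\<lambda>a. (f a, a)) w)"

text \<open>A strictly sorted list is determined by its set, and second components recover the word
  from the list of pairs.\<close>

lemma word_partition_unique:
  assumes "word_partition f w" "word_partition f w'" "set w = set w'"
  shows "w = w'"
proof -
  have "map (\<lambda>a. (f a, a)) w = map (\<lambda>a. (f a, a)) w'"
    using assms by (intro strict_sorted_equal) (auto simp: word_partition_def)
  then have "map snd (map (\<lambda>a. (f a, a)) w) = map snd (map (\<lambda>a. (f a, a)) w')" by simp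
  then show ?thesis by (simp add: o_def)
qed

lemma word_partition_exists:
  assumes "finite A"
  obtains w where "w \<in> permutations_of_set A" "word_partition f w"
proof
  let ?xs = "sorted_list_of_set ((\<lambda>a. (f a, a)) ` A)"
  have set: "set ?xs = (\<lambda>a. (f a, a)) ` A" using assms by simp
  have "map (\<lambda>a. (f a, a)) (map snd ?xs) = map id ?xs"
    unfolding map_map by (rule map_cong) (use set in auto)
  then show "word_partition f (map snd ?xs)"
    by (simp add: word_partition_def)
  have "set (map snd ?xs) = A" using set by force
  moreover have "distinct (map snd ?xs)"
    unfolding distinct_map using set by (auto simp: inj_on_def)
  ultimately show "map snd ?xs \<in> permutations_of_set A"
    by (simp add: permutations_of_set_def)
qed

lemma word_partition_filter: "word_partition f w \<Longrightarrow> word_partition f (filter P w)"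
  by (auto simp: word_partition_def sorted_wrt_map intro: sorted_wrt_filter)

lemma word_partition_cong:
  "(\<And>a. a \<in> set w \<Longrightarrow> f a = g a) \<Longrightarrow> word_partition f w = word_partition g w"
  unfolding word_partition_def by (metis (no_types, lifting) map_cong)

text \<open>By transitivity only neighbours matter. Neighbouring letters differ, so a tie in
  \<open>f\<close> is allowed exactly at an ascent.\<close>

lemma word_partition_nth:
  assumes "distinct w"
  shows "word_partition f w \<longleftrightarrow> sorted (map f w) \<and>
    (\<forall>i. Suc i < length w \<longrightarrow> w ! i > w ! Suc i \<longrightarrow> f (w ! i) < f (w ! Suc i))"
proof -
  have ne: "w ! i \<noteq> w ! Suc i" if "Suc i < length w" for i
    using assms that by (simp add: nth_eq_iff_index_eq)
  have "word_partition f w \<longleftrightarrow> (\<forall>i. Suc i < length w \<longrightarrow>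
      f (w ! i) < f (w ! Suc i) \<or> f (w ! i) \<le> f (w ! Suc i) \<and> w ! i < w ! Suc i)"
    by (simp add: word_partition_def sorted_wrt_iff_nth_Suc_transp)
  also have "\<dots> \<longleftrightarrow> (\<forall>i. Suc i < length w \<longrightarrow> f (w ! i) \<le> f (w ! Suc i)) \<and>
      (\<forall>i. Suc i < length w \<longrightarrow> w ! i > w ! Suc i \<longrightarrow> f (w ! i) < f (w ! Suc i))"
    using ne by (meson less_imp_le linorder_neqE not_less order.asym)
  also have "(\<forall>i. Suc i < length w \<longrightarrow> f (w ! i) \<le> f (w ! Suc i)) \<longleftrightarrow> sorted (map f w)"
    by (simp add: sorted_wrt_iff_nth_Suc_transp)
  finally show ?thesis .
qed

text \<open>
  The last cyclic position of the rotation \<open>rotate m u\<close> is position \<open>m\<close> (modulo the length) of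
  \<open>u\<close>: this is the cyclic descent that imposes no condition.
\<close>

lemma word_partition_rotate:
  assumes "distinct u" and m: "m < length u"
  shows "word_partition f (rotate m u) \<longleftrightarrow> sorted (rotate m (map f u)) \<and>
    (\<forall>j \<in> cDes u. j mod length u \<noteq> m \<longrightarrow> map f u ! (j - 1) < map f u ! (j mod length u))"
proof -
  let ?n = "length u"
  let ?p = "rotate m u"
  have n: "?n > 0" using m by linarith
  have nth: "?p ! i = u ! ((m + i) mod ?n)" if "i < ?n" for i
    using that by (simp add: nth_rotate)
  have "(\<forall>i. Suc i < ?n \<longrightarrow> ?p ! i > ?p ! Suc i \<longrightarrow> f (?p ! i) < f (?p ! Suc i)) \<longleftrightarrow>
    (\<forall>j \<in> cDes u. j mod ?n \<noteq> m \<longrightarrow> f (u ! (j - 1)) < f (u ! (j mod ?n)))" (is "?L \<longleftrightarrow> ?R")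
  proof
    assume L: ?L
    show ?R
    proof (intro ballI impI)
      fix j assume j: "j \<in> cDes u" "j mod ?n \<noteq> m"
      then have j1: "1 \<le> j" "j \<le> ?n" and des: "u ! (j - 1) > u ! (j mod ?n)"
        by (auto simp: cDes_def)
      \<comment> \<open>Position in the rotated word of the letter \<open>u ! (j - 1)\<close>; the
        case split keeps the natural subtraction exact.\<close>
      define i where "i = (if m \<le> j - 1 then j - 1 - m else j - 1 + ?n - m)"
      have i: "(m + i) mod ?n = j - 1" "i < ?n"
      proof -
        have "m + i = j - 1 \<or> m + i = j - 1 + ?n" using m by (auto simp: i_def)
        then have "(m + i) mod ?n = (j - 1) mod ?n" by (metis mod_add_self2)
        also have "\<dots> = j - 1" using j1 by (intro mod_less) linarith
        finally show "(m + i) mod ?n = j - 1" .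
        show "i < ?n" unfolding i_def using j1 m by (cases "m \<le> j - 1") simp_all
      qed
      have Si: "(m + Suc i) mod ?n = j mod ?n"
        using i(1) j1(1) by (metis Suc_diff_1 add_Suc_right less_eq_Suc_le mod_Suc_eq One_nat_def)
      \<comment> \<open>Otherwise the pair would wrap around from the last letter of
        \<open>?p\<close> to its first, which is the excluded position.\<close>
      have "Suc i \<noteq> ?n"
      proof
        assume "Suc i = ?n"
        then have "(m + Suc i) mod ?n = m" using m by (simp only: mod_add_self2 mod_less)
        then show False using Si j(2) by simp
      qed
      then have "Suc i < ?n" using i(2) by simp
      with L des show "f (u ! (j - 1)) < f (u ! (j mod ?n))"
        using nth[of i] nth[of "Suc i"] i Si by auto
    qed
  next
    assume R: ?R
    show ?L
    proof (intro allI impI)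
      fix i assume i: "Suc i < ?n" and des: "?p ! i > ?p ! Suc i"
      \<comment> \<open>The 1-based position in \<open>u\<close> of the letter
        \<open>?p ! i\<close>, matching the indexing of \<open>cDes\<close>: the last position is
        \<open>?n\<close>, not 0.\<close>
      define j where "j = Suc ((m + i) mod ?n)"
      have j: "j \<in> {1..?n}" "j - 1 = (m + i) mod ?n" "j mod ?n = (m + Suc i) mod ?n"
        using n by (auto simp: j_def mod_Suc_eq Suc_le_eq)
      have "j mod ?n \<noteq> m"
      proof
        assume "j mod ?n = m"
        then have "(m + Suc i) mod ?n = m" using j(3) by simp
        moreover have "(m + Suc i) mod ?n = (if m + Suc i < ?n then m + Suc i else m + Suc i - ?n)"
          using i m by (subst mod_if) simp
        ultimately show False using i by (simp split: if_splits)
      qed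
      moreover have "j \<in> cDes u"
        using des j nth[of i] nth[of "Suc i"] i by (simp add: cDes_def)
      ultimately show "f (?p ! i) < f (?p ! Suc i)"
        using R nth[of i] nth[of "Suc i"] i j by auto
    qed
  qed
  moreover have "map f u ! (j - 1) = f (u ! (j - 1))" "map f u ! (j mod ?n) = f (u ! (j mod ?n))"
    if "j \<in> cDes u" for j
    using that n by (auto simp: cDes_def)
  ultimately show ?thesis
    using word_partition_nth[of ?p f] assms by (simp add: rotate_map)
qed

section \<open>Fundamental cyclic quasi-symmetric functions as enumerators of labellings\<close>

text \<open>Extensional functions are fixed by their values on \<open>A\<close>, so cardinalities
  count labellings of \<open>A\<close> only.\<close>

definition labellings :: "'a set \<Rightarrow> 'a::linorder list set \<Rightarrow> nat multiset \<Rightarrow> ('a \<Rightarrow> nat) set" where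
  "labellings A W M = {f \<in> A \<rightarrow>\<^sub>E {1..}. (\<exists>w \<in> W. word_partition f w) \<and> image_mset f (mset_set A) = M}"

lemma finite_labellings:
  assumes "finite A"
  shows "finite (labellings A W M)"
proof (rule finite_subset)
  show "labellings A W M \<subseteq> A \<rightarrow>\<^sub>E set_mset M"
    using assms by (auto simp: labellings_def PiE_def)
  show "finite (A \<rightarrow>\<^sub>E set_mset M)"
    using assms by (simp add: finite_PiE)
qed

text \<open>Both sides count the pairs \<open>?Q\<close>. Reading \<open>f\<close> along
  \<open>u\<close> turns them into the pairs of \<open>cyc_pairs\<close>; forgetting
  \<open>k\<close> loses nothing, since \<open>f\<close> determines its word, whose first letter
  locates \<open>k\<close> in the distinct word \<open>u\<close>.\<close>

lemma card_labellings_cyc_class: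
  assumes "distinct u" "u \<noteq> []"
  shows "card {(x, k). (x, k) \<in> cyc_pairs (length u) (cDes u) \<and> mset x = M} =
    card (labellings (set u) (cyc_class u) M)"
proof -
  let ?n = "length u"
  let ?Q = "{(f, k). f \<in> set u \<rightarrow>\<^sub>E {1..} \<and> k \<in> {1..?n} \<and>
      word_partition f (rotate (k - 1) u) \<and> image_mset f (mset_set (set u)) = M}"
  let ?P = "{(x, k). (x, k) \<in> cyc_pairs ?n (cDes u) \<and> mset x = M}"
  have mset: "image_mset f (mset_set (set u)) = mset (map f u)" for f :: "int \<Rightarrow> nat"
    using assms by (simp add: mset_set_set)
  have wp: "word_partition f (rotate (k - 1) u) \<longleftrightarrow> sorted (rotate (k - 1) (map f u)) \<and>
      (\<forall>j \<in> cDes u. j mod ?n \<noteq> (k - 1) mod ?n \<longrightarrow> map f u ! (j - 1) < map f u ! (j mod ?n))"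
    if "k \<in> {1..?n}" for f k
  proof -
    have "k - 1 < ?n" using that by auto
    then show ?thesis using word_partition_rotate[OF assms(1), of "k - 1" f] by simp
  qed
  have P: "bij_betw (\<lambda>(f, k). (map f u, k)) ?Q ?P"
    unfolding bij_betw_def
  proof
    show "inj_on (\<lambda>(f, k). (map f u, k)) ?Q"
    proof (rule inj_onI, clarsimp)
      fix f g :: "int \<Rightarrow> nat"
      assume fg: "f \<in> set u \<rightarrow>\<^sub>E {Suc 0..}" "g \<in> set u \<rightarrow>\<^sub>E {Suc 0..}" "\<forall>a \<in> set u. f a = g a"
      show "f = g" by (rule PiE_ext[OF fg(1,2)]) (simp add: fg(3))
    qed
    show "(\<lambda>(f, k). (map f u, k)) ` ?Q = ?P"
    proof (intro equalityI subsetI)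
      fix y assume "y \<in> (\<lambda>(f, k). (map f u, k)) ` ?Q"
      then obtain f k where "y = (map f u, k)" "(f, k) \<in> ?Q" by auto
      then show "y \<in> ?P"
        using wp[of k f] mset[of f] by (auto simp: cyc_pairs_def)
    next
      fix y assume "y \<in> ?P"
      then obtain x k where y: "y = (x, k)" and xk: "(x, k) \<in> cyc_pairs ?n (cDes u)" "mset x = M"
        by auto
      define f where "f = restrict (the \<circ> map_of (zip u x)) (set u)"
      have len: "length x = ?n" and k: "k \<in> {1..?n}" using xk by (auto simp: cyc_pairs_def)
      have x: "map f u = x"
        using assms(1) len by (intro nth_equalityI) (auto simp: f_def map_of_zip_nth)
      have "f a \<in> {1..}" if "a \<in> set u" for a
      proof -
        have "f a \<in> set x" using that x by force
        then show ?thesis using xk(1) by (auto simp: cyc_pairs_def)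
      qed
      then have "f \<in> set u \<rightarrow>\<^sub>E {1..}" by (auto simp: f_def)
      then have "(f, k) \<in> ?Q"
        using wp[OF k, of f] xk k x mset[of f] by (auto simp: cyc_pairs_def)
      then show "y \<in> (\<lambda>(f, k). (map f u, k)) ` ?Q" using x y by force
    qed
  qed
  have L: "bij_betw fst ?Q (labellings (set u) (cyc_class u) M)"
    unfolding bij_betw_def
  proof
    show "inj_on fst ?Q"
    proof (rule inj_onI)
      fix p q assume p: "p \<in> ?Q" and q: "q \<in> ?Q" and "fst p = fst q"
      then obtain f k l where pq: "p = (f, k)" "q = (f, l)"
        by (metis prod.collapse)
      have k: "1 \<le> k" "k \<le> ?n" "word_partition f (rotate (k - 1) u)"
        and l: "1 \<le> l" "l \<le> ?n" "word_partition f (rotate (l - 1) u)"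
        using p q by (simp_all add: pq)
      have "hd (rotate (k - 1) u) = hd (rotate (l - 1) u)"
        by (rule arg_cong[OF word_partition_unique[OF k(3) l(3)]]) simp
      moreover have lt: "k - 1 < ?n" "l - 1 < ?n" using k l by linarith+
      ultimately have "u ! (k - 1) = u ! (l - 1)"
        by (simp only: hd_rotate_conv_nth[OF assms(2)] mod_less)
      then have "k - 1 = l - 1" using nth_eq_iff_index_eq[OF assms(1) lt] by blast
      then show "p = q" using k(1) l(1) pq by simp
    qed
    show "fst ` ?Q = labellings (set u) (cyc_class u) M"
    proof (intro equalityI subsetI)
      fix f assume "f \<in> fst ` ?Q"
      then show "f \<in> labellings (set u) (cyc_class u) M"
        by (auto simp: labellings_def cyc_class_def)
    next
      fix f assume f: "f \<in> labellings (set u) (cyc_class u) M"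
      then obtain i where "word_partition f (rotate i u)"
        by (auto simp: labellings_def cyc_class_def)
      \<comment> \<open>The rotation amount is reduced modulo the length and shifted by one to give
        an admissible 1-based \<open>k\<close>.\<close>
      then have "word_partition f (rotate (Suc (i mod ?n) - 1) u)"
        by (simp add: rotate_conv_mod[of i])
      then have "(f, Suc (i mod ?n)) \<in> ?Q"
        using f assms(2) by (auto simp: labellings_def Suc_le_eq)
      then show "f \<in> fst ` ?Q" by force
    qed
  qed
  show ?thesis
    by (rule trans[OF bij_betw_same_card[OF P, symmetric] bij_betw_same_card[OF L]])
qed

lemma mv_coeff_Fcyc:
  assumes "distinct u"
  shows "mv_coeff (Fcyc (length u) (cDes u)) M = int (card (labellings (set u) (cyc_class u) M))"
proof (cases "u = []")
  case True
  \<comment> \<open>The empty alphabet has a single labelling, with the empty monomial, which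
    matches the convention that the series for length 0 is 1.\<close>
  have "labellings (set u) (cyc_class u) M = (if M = {#} then {\<lambda>_. undefined} else {})"
    by (auto simp: True labellings_def cyc_class_def word_partition_def)
  then show ?thesis by (simp add: True Fcyc_def one_mvps.rep_eq)
next
  case False
  then show ?thesis
    using card_labellings_cyc_class[OF assms] by (simp add: Fcyc_def Abs_mvps_inverse)
qed

section \<open>Restricting labellings to a disjoint union\<close>

text \<open>The filtered word is still ordered by \<open>h\<close>, hence it is the unique word of
  the restriction to \<open>A\<close>.\<close>

lemma word_partition_restrict:
  assumes h: "word_partition h w" and sub: "A \<subseteq> set w" and U: "\<And>x. x \<in> U \<Longrightarrow> set x = A"
  shows "(\<exists>x \<in> U. word_partition (restrict h A) x) \<longleftrightarrow> filter (\<lambda>x. x \<in> A) w \<in> U"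
proof -
  have "word_partition h (filter (\<lambda>x. x \<in> A) w)" "set (filter (\<lambda>x. x \<in> A) w) = A"
    using word_partition_filter[OF h] sub by auto
  moreover have "word_partition (restrict h A) x \<longleftrightarrow> word_partition h x" if "set x = A" for x
    using that by (intro word_partition_cong) auto
  ultimately show ?thesis
    using word_partition_unique U by metis
qed

text \<open>This is the product formula on coefficients: gluing labellings of \<open>A\<close> and
  \<open>B\<close> multiplies their monomials, and the word of the glued labelling filters to their
  two words.\<close>

lemma card_labellings_disjoint_union:
  assumes fin: "finite A" "finite B" and disj: "A \<inter> B = {}"
    and U: "\<And>x. x \<in> U \<Longrightarrow> set x = A" and V: "\<And>x. x \<in> V \<Longrightarrow> set x = B"
  shows "(\<Sum>(N, K) \<in> splits M. card (labellings A U N) * card (labellings B V K)) =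
    card (labellings (A \<union> B) {w \<in> permutations_of_set (A \<union> B).
      filter (\<lambda>x. x \<in> A) w \<in> U \<and> filter (\<lambda>x. x \<in> B) w \<in> V} M)"
    (is "_ = card (labellings _ ?W M)")
proof -
  let ?S = "\<Union>(N, K) \<in> splits M. labellings A U N \<times> labellings B V K"
  have "(\<Sum>(N, K) \<in> splits M. card (labellings A U N) * card (labellings B V K)) =
      (\<Sum>p \<in> splits M. card (case p of (N, K) \<Rightarrow> labellings A U N \<times> labellings B V K))"
    by (intro sum.cong) (auto simp: card_cartesian_product)
  \<comment> \<open>The products are disjoint because a pair of labellings determines its monomials
    \<open>N\<close> and \<open>K\<close>.\<close>
  also have "\<dots> = card ?S"
    by (subst card_UN_disjoint) (auto intro: finite_labellings fin, auto simp: labellings_def)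
  also have "\<dots> = card (labellings (A \<union> B) ?W M)"
  proof (rule bij_betw_same_card[symmetric], rule bij_betwI)
    let ?r = "\<lambda>h. (restrict h A, restrict h B)"
    let ?m = "\<lambda>(f, g) x. if x \<in> A then f x else g x"
    have key: "h \<in> labellings (A \<union> B) ?W M \<longleftrightarrow> ?r h \<in> ?S" if h: "h \<in> A \<union> B \<rightarrow>\<^sub>E {1..}" for h
    proof -
      obtain w where w: "w \<in> permutations_of_set (A \<union> B)" "word_partition h w"
        using word_partition_exists fin by (meson finite_UnI)
      then have set: "set w = A \<union> B" by (simp add: permutations_of_set_def)
      \<comment> \<open>By uniqueness, the existential collapses to a condition on the one word
        \<open>w\<close> of \<open>h\<close>.\<close>
      have "(\<exists>x \<in> ?W. word_partition h x) \<longleftrightarrow> w \<in> ?W"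
      proof
        assume "\<exists>x \<in> ?W. word_partition h x"
        then obtain x where "x \<in> ?W" "word_partition h x" by blast
        moreover from this have "x = w"
          using w set word_partition_unique[of h x w] by (auto simp: permutations_of_set_def)
        ultimately show "w \<in> ?W" by simp
      qed (use w in blast)
      also have "\<dots> \<longleftrightarrow> (\<exists>x \<in> U. word_partition (restrict h A) x) \<and>
          (\<exists>x \<in> V. word_partition (restrict h B) x)"
        using word_partition_restrict[OF w(2), of A U] word_partition_restrict[OF w(2), of B V]
          U V set w(1) by auto
      finally have words: "(\<exists>x \<in> ?W. word_partition h x) \<longleftrightarrow>
          (\<exists>x \<in> U. word_partition (restrict h A) x) \<and> (\<exists>x \<in> V. word_partition (restrict h B) x)" .
      have "image_mset (restrict h A) (mset_set A) = image_mset h (mset_set A)"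
        "image_mset (restrict h B) (mset_set B) = image_mset h (mset_set B)"
        using fin by (auto intro!: image_mset_cong)
      then have "image_mset h (mset_set (A \<union> B)) =
          image_mset (restrict h A) (mset_set A) + image_mset (restrict h B) (mset_set B)"
        using fin disj by (simp add: mset_set_Union)
      moreover have "restrict h A \<in> A \<rightarrow>\<^sub>E {1..}" "restrict h B \<in> B \<rightarrow>\<^sub>E {1..}"
        using h by (auto simp: PiE_iff)
      ultimately show ?thesis
        using words h by (auto simp: labellings_def splits_def)
    qed
    have ext: "?m p \<in> A \<union> B \<rightarrow>\<^sub>E {1..} \<and> ?r (?m p) = p" if "p \<in> ?S" for p
    proof -
      obtain f g where p: "p = (f, g)" "f \<in> A \<rightarrow>\<^sub>E {1..}" "g \<in> B \<rightarrow>\<^sub>E {1..}"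
        using \<open>p \<in> ?S\<close> by (auto simp: labellings_def)
      have "restrict (?m p) A = f" "restrict (?m p) B = g"
        using p disj by (auto simp: fun_eq_iff PiE_def extensional_def)
      moreover have "?m p \<in> A \<union> B \<rightarrow>\<^sub>E {1..}"
        using p by (auto simp: PiE_iff extensional_def)
      ultimately show ?thesis using p by simp
    qed
    have PiE: "h \<in> A \<union> B \<rightarrow>\<^sub>E {1..}" if "h \<in> labellings (A \<union> B) ?W M" for h
      using that by (simp add: labellings_def)
    show "?r \<in> labellings (A \<union> B) ?W M \<rightarrow> ?S"
      using key PiE by blast
    show "?m \<in> ?S \<rightarrow> labellings (A \<union> B) ?W M"
    proof
      fix p assume "p \<in> ?S"
      then show "?m p \<in> labellings (A \<union> B) ?W M"
        using key[of "?m p"] ext[of p] by simp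
    qed
    show "?m (?r h) = h" if "h \<in> labellings (A \<union> B) ?W M" for h
      using PiE[OF that] by (auto simp: fun_eq_iff PiE_def extensional_def)
    show "?r (?m p) = p" if "p \<in> ?S" for p
      using ext[OF that] by simp
  qed
  finally show ?thesis .
qed

section \<open>Sorting labellings by cyclic shuffle and comparing coefficients\<close>

lemma mv_coeff_sum: "mv_coeff (\<Sum>i \<in> I. F i) M = (\<Sum>i \<in> I. mv_coeff (F i) M)"
  by (induction I rule: infinite_finite_induct) (simp_all add: zero_mvps.rep_eq plus_mvps.rep_eq)

text \<open>The filter conditions are invariant under rotation, so they hold for a whole cyclic
  class or for none of its words.\<close>

lemma Union_cyc_shuffles:
  "\<Union> (cyc_shuffles u v) = {w \<in> permutations_of_set (set u \<union> set v).
     filter (\<lambda>x. x \<in> set u) w \<in> cyc_class u \<and> filter (\<lambda>x. x \<in> set v) w \<in> cyc_class v}"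
    (is "_ = ?R")
proof (intro equalityI subsetI)
  fix w assume "w \<in> \<Union> (cyc_shuffles u v)"
  then obtain x where wx: "w \<in> cyc_class x" and x: "x \<in> permutations_of_set (set u \<union> set v)"
    and sh: "\<exists>w' \<in> cyc_class x. \<exists>u' \<in> cyc_class u. \<exists>v' \<in> cyc_class v.
      subseq u' w' \<and> subseq v' w'"
    unfolding cyc_shuffles_def by blast
  have "x \<in> ?R"
    using x sh cyclic_shuffle_iff[of x u v] by (simp add: permutations_of_set_def)
  then show "w \<in> ?R"
    using filter_mem_cyc_class[OF wx] cyc_class_invariants[OF wx]
    by (simp add: permutations_of_set_def)
next
  fix w assume "w \<in> ?R"
  then have "cyc_class w \<in> cyc_shuffles u v"
    using cyclic_shuffle_iff[of w u v] by (auto simp: cyc_shuffles_def permutations_of_set_def)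
  then show "w \<in> \<Union> (cyc_shuffles u v)" using self_in_cyc_class by blast
qed

lemma cyc_shuffles_eq_cyc_class:
  assumes "W \<in> cyc_shuffles u v" "w \<in> W"
  shows "cyc_class w = W"
  using assms cyc_class_eq by (auto simp: cyc_shuffles_def)

theorem theorem3p22:
  fixes A B C :: "int set"
    and u v :: "int list"
    and rep :: "int list set \<Rightarrow> int list"
  assumes "finite A" and "finite B"
    and "A \<inter> B = {}" and "C = A \<union> B"
    and "u \<in> permutations_of_set A" and "v \<in> permutations_of_set B"
    and "\<And>W. W \<in> cyc_shuffles u v \<Longrightarrow> rep W \<in> W"
  shows "Fcyc (card A) (cDes u) * Fcyc (card B) (cDes v) =
    (\<Sum>W \<in> cyc_shuffles u v. Fcyc (card C) (cDes (rep W)))"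
proof -
  have u: "distinct u" "set u = A" "card A = length u"
    and v: "distinct v" "set v = B" "card B = length v"
    using assms(5,6) by (auto simp: permutations_of_set_def distinct_card)
  have mem: "w \<in> permutations_of_set C" if "W \<in> cyc_shuffles u v" "w \<in> W" for w W
    using that Union_cyc_shuffles[of u v] u v assms(4) by auto
  have "mv_coeff (Fcyc (card A) (cDes u) * Fcyc (card B) (cDes v)) M =
      mv_coeff (\<Sum>W \<in> cyc_shuffles u v. Fcyc (card C) (cDes (rep W))) M" for M
  proof -
    have "mv_coeff (Fcyc (card A) (cDes u) * Fcyc (card B) (cDes v)) M =
        (\<Sum>(N, K) \<in> splits M. mv_coeff (Fcyc (length u) (cDes u)) N
          * mv_coeff (Fcyc (length v) (cDes v)) K)"
      using u v by (simp add: times_mvps.rep_eq)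
    also have "\<dots> = int (\<Sum>(N, K) \<in> splits M.
        card (labellings A (cyc_class u) N) * card (labellings B (cyc_class v) K))"
      unfolding of_nat_sum
      by (intro sum.cong) (auto simp: mv_coeff_Fcyc u v)
    also have "\<dots> = int (card (labellings C (\<Union> (cyc_shuffles u v)) M))"
      using card_labellings_disjoint_union[OF assms(1-3), of "cyc_class u" "cyc_class v" M]
        cyc_class_invariants(1)[of _ u] cyc_class_invariants(1)[of _ v] assms(4) u v
      by (simp add: Union_cyc_shuffles del: of_nat_sum)
    also have "labellings C (\<Union> (cyc_shuffles u v)) M =
        (\<Union>W \<in> cyc_shuffles u v. labellings C W M)"
      by (auto simp: labellings_def)
    also have "card \<dots> = (\<Sum>W \<in> cyc_shuffles u v. card (labellings C W M))"
    proof (rule card_UN_disjoint, goal_cases)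
      case 1
      show ?case by (rule finite_cyc_shuffles)
    next
      case 2
      show ?case using assms(1,2,4) finite_labellings by blast
    next
      case 3
      \<comment> \<open>A labelling has only one word on \<open>C\<close>, and that word lies in
        only one cyclic class.\<close>
      have "W = W'" if W: "W \<in> cyc_shuffles u v" "W' \<in> cyc_shuffles u v"
        and f: "f \<in> labellings C W M" "f \<in> labellings C W' M" for W W' f
      proof -
        obtain w w' where w: "w \<in> W" "word_partition f w" "w' \<in> W'" "word_partition f w'"
          using f by (auto simp: labellings_def)
        then have "w = w'"
          using mem W by (intro word_partition_unique) (auto simp: permutations_of_set_def)
        then show ?thesis using cyc_shuffles_eq_cyc_class W w by metis
      qed
      then show ?case by blast
    qed
    also have "int \<dots> = (\<Sum>W \<in> cyc_shuffles u v. mv_coeff (Fcyc (card C) (cDes (rep W))) M)"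
      unfolding of_nat_sum
    proof (rule sum.cong)
      fix W assume W: "W \<in> cyc_shuffles u v"
      note rep = assms(7)[OF W]
      have "distinct (rep W)" "set (rep W) = C" "card C = length (rep W)"
        using mem[OF W rep] by (auto simp: permutations_of_set_def distinct_card)
      \<comment> \<open>The count involves only the class \<open>W\<close>, so any representative
        \<open>rep W\<close> gives the same series.\<close>
      then show "int (card (labellings C W M)) = mv_coeff (Fcyc (card C) (cDes (rep W))) M"
        using mv_coeff_Fcyc[of "rep W" M] cyc_shuffles_eq_cyc_class[OF W rep] by simp
    qed simp
    finally show ?thesis by (simp add: mv_coeff_sum)
  qed
  then show ?thesis by (simp add: mv_coeff_inject[symmetric] fun_eq_iff)
qed

end
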